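(* Let $(F^*,\mathrm{d},\wedge)$ be a differential graded algebra over $k$ ($k=\mathbb{R}$ or $\mathbb{C}$), let $\delta:F^n\to F^{n-1}$ (all $n\ge 0$) be a linear map (no further conditions on $\delta$), put $\Delta=\delta\,\mathrm{d}+\mathrm{d}\,\delta:F^n\to F^n$, and let $\alpha\in\mathbb{R}$. On $F_{\mathbb{R}}^n=F^n\otimes C^\infty(\mathbb{R})\oplus\big(F^{n-1}\otimes C^\infty(\mathbb{R})\big)\wedge \mathrm{d}t$ define, for $\xi\in F^n\otimes C^\infty(\mathbb{R})$ and $\eta\in F^m\otimes C^\infty(\mathbb{R})$, $$\mathrm{d}_\alpha(\xi)=\mathrm{d}\xi+(-1)^n\,\frac{\partial\xi}{\partial t}\wedge \mathrm{d}t+(-1)^n\alpha\,\Delta(\xi)\wedge \mathrm{d}t,\qquad \mathrm{d}_\alpha(\xi\wedge \mathrm{d}t)=\mathrm{d}\xi\wedge \mathrm{d}t,$$ $$\xi\wedge_\alpha\eta=\xi\wedge\eta-(-1)^{n+m}\alpha\big(\delta(\xi\wedge\eta)-\delta(\xi)\wedge\eta-(-1)^n\,\xi\wedge\delta(\eta)\big)\wedge \mathrm{d}t,$$ $$(\xi\wedge \mathrm{d}t)\wedge_\alpha\eta=(-1)^m(\xi\wedge\eta)\wedge \mathrm{d}t,\quad \xi\wedge_\alpha(\eta\wedge \mathrm{d}t)=(\xi\wedge\eta)\wedge \mathrm{d}t,\quad (\xi\wedge \mathrm{d}t)\wedge_\alpha(\eta\wedge \mathrm{d}t)=0.$$ Then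 $(F_{\mathbb{R}}^*,\mathrm{d}_\alpha,\wedge_\alpha)$ is a differential graded algebra.
   Context: A differential graded algebra (DGA) $(F^*,\mathrm{d},\wedge)$ consists of vector spaces $F^n$, $n\ge 0$, over $k=\mathbb{R}$ or $\mathbb{C}$ (with $F^n=0$ for $n<0$), linear maps $\mathrm{d}:F^n\to F^{n+1}$ and an associative bilinear product $\wedge:F^n\times F^m\to F^{n+m}$ such that $\mathrm{d}\,\mathrm{d}=0$ and $\mathrm{d}(\xi\wedge\eta)=\mathrm{d}\xi\wedge\eta+(-1)^{|\xi|}\xi\wedge \mathrm{d}\eta$, where $|\xi|=n$ for $\xi\in F^n$. Graded commutativity is not assumed. $C^\infty(\mathbb{R})$ denotes smooth $k$-valued functions of the time variable $t$; elements of $F^n\otimes C^\infty(\mathbb{R})$ are thought of as time-dependent elements of $F^n$. The operations $\mathrm{d},\wedge,\delta,\Delta$ are applied to elements of $F^*\otimes C^\infty(\mathbb{R})$ pointwise in $t$, e.g. $(\mathrm{d}\xi)(t)=\mathrm{d}(\xi(t))$, and $\partial/\partial t$ acts on the factor $C^\infty(\mathbb{R})$. The symbol $\wedge \mathrm{d}t$ is a formal marker for the second summand of $F_{\mathbb{R}}^n$. *)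

theory Defs
  imports "HOL-Analysis.Analysis" "HOL-Library.Function_Algebras"
begin

text \<open>The base field \<open>k\<close> is a type of class \<^class>\<open>real_normed_field\<close> wherever analysis is
  involved; \<^typ>\<open>real\<close> and \<^typ>\<open>complex\<close> are instances and, by Gelfand--Mazur, the only ones up
  to isomorphism.\<close>

section \<open>Differential graded algebras\<close>

definition linear_map_on ::
  "('k \<Rightarrow> 'a \<Rightarrow> 'a) \<Rightarrow> ('k \<Rightarrow> 'b \<Rightarrow> 'b) \<Rightarrow> 'a set \<Rightarrow> 'b set \<Rightarrow> ('a::ab_group_add \<Rightarrow> 'b::ab_group_add) \<Rightarrow> bool"
where
  "linear_map_on s1 s2 V W f \<longleftrightarrow>
     (\<forall>x\<in>V. f x \<in> W) \<and>
     (\<forall>x\<in>V. \<forall>y\<in>V. f (x + y) = f x + f y) \<and>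
     (\<forall>c. \<forall>x\<in>V. f (s1 c x) = s2 c (f x))"

text \<open>The spaces \<open>F n\<close> are subspaces of one ambient vector space, which need not be their direct sum.
  The degree is an integer, with \<open>F n = {0}\<close> for \<open>n < 0\<close>, and the operations
  carry the degrees of their arguments, so they are constrained only on the \<open>F n\<close>.
  There is neither a unit nor graded commutativity.\<close>

locale dga = vector_space smul
  for smul :: "'k::field \<Rightarrow> 'a::ab_group_add \<Rightarrow> 'a" (infixr \<open>*s\<close> 75) +
  fixes F :: "int \<Rightarrow> 'a set"
    and d :: "int \<Rightarrow> 'a \<Rightarrow> 'a"
    and w :: "int \<Rightarrow> int \<Rightarrow> 'a \<Rightarrow> 'a \<Rightarrow> 'a"
  assumes subspace_F: "subspace (F n)"
    and F_neg: "n < 0 \<Longrightarrow> F n = {0}"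
    and d_linear: "linear_map_on smul smul (F n) (F (n + 1)) (d n)"
    and w_linear_left: "y \<in> F m \<Longrightarrow> linear_map_on smul smul (F n) (F (n + m)) (\<lambda>x. w n m x y)"
    and w_linear_right: "x \<in> F n \<Longrightarrow> linear_map_on smul smul (F m) (F (n + m)) (\<lambda>y. w n m x y)"
    and w_assoc: "\<lbrakk>x \<in> F n; y \<in> F m; z \<in> F p\<rbrakk> \<Longrightarrow>
      w (n + m) p (w n m x y) z = w n (m + p) x (w m p y z)"
    and d_d: "x \<in> F n \<Longrightarrow> d (n + 1) (d n x) = 0"
    and leibniz: "\<lbrakk>x \<in> F n; y \<in> F m\<rbrakk> \<Longrightarrow>
      d (n + m) (w n m x y) = w (n + 1) m (d n x) y + ((-1) powi n) *s w n (m + 1) x (d m y)"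

section \<open>Time-dependent elements\<close>

definition dt :: "(real \<Rightarrow> 'k::real_normed_field) \<Rightarrow> real \<Rightarrow> 'k" where
  "dt f = (\<lambda>t. vector_derivative f (at t))"

definition smooth :: "(real \<Rightarrow> 'k::real_normed_field) \<Rightarrow> bool" where
  "smooth f \<longleftrightarrow> (\<forall>n t. (dt ^^ n) f differentiable (at t))"

text \<open>\<open>V \<otimes> C\<^sup>\<infinity>(\<real>)\<close> is the algebraic tensor product, realised as the space of those functions
  \<open>\<real> \<rightarrow> V\<close> that are finite sums \<open>t \<mapsto> \<Sum>\<^sub>i f\<^sub>i(t) v\<^sub>i\<close> with \<open>f\<^sub>i\<close> smooth and \<open>v\<^sub>i \<in> V\<close>.
  Lemma \<open>smooth_tensor_universal\<close> below is its universal property.\<close>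

definition tensor_sum :: "('k \<Rightarrow> 'a \<Rightarrow> 'a::ab_group_add) \<Rightarrow> ((real \<Rightarrow> 'k) \<times> 'a) list \<Rightarrow> real \<Rightarrow> 'a" where
  "tensor_sum smul xs = (\<lambda>t. \<Sum>(f, v)\<leftarrow>xs. smul (f t) v)"

definition smooth_tensor ::
  "('k::real_normed_field \<Rightarrow> 'a::ab_group_add \<Rightarrow> 'a) \<Rightarrow> 'a set \<Rightarrow> (real \<Rightarrow> 'a) set" where
  "smooth_tensor smul V = {tensor_sum smul xs | xs. set xs \<subseteq> {f. smooth f} \<times> V}"

text \<open>The operator \<open>\<partial>/\<partial>t\<close> differentiates the factor in \<open>C\<^sup>\<infinity>(\<real>)\<close>. No topology on the vector space is
  involved; that the result does not depend on the chosen
  presentation is \<open>ddt_tensor_sum\<close> below.\<close>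

definition ddt :: "('k::real_normed_field \<Rightarrow> 'a::ab_group_add \<Rightarrow> 'a) \<Rightarrow> (real \<Rightarrow> 'a) \<Rightarrow> real \<Rightarrow> 'a" where
  "ddt smul \<xi> = (THE \<eta>. \<exists>xs. set xs \<subseteq> {f. smooth f} \<times> UNIV \<and>
     \<xi> = tensor_sum smul xs \<and> \<eta> = tensor_sum smul (map (\<lambda>(f, v). (dt f, v)) xs))"

definition pointwise_scale :: "('k \<Rightarrow> 'a \<Rightarrow> 'a) \<Rightarrow> 'k \<Rightarrow> (real \<Rightarrow> 'a) \<Rightarrow> real \<Rightarrow> 'a" where
  "pointwise_scale smul c \<xi> = (\<lambda>t. smul c (\<xi> t))"

subsection \<open>Adequacy of the model of the tensor product\<close>

lemma dt_funpow_linear: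
  assumes "smooth f" "smooth g"
  shows "(dt ^^ n) (\<lambda>t. c * f t + g t) = (\<lambda>t. c * (dt ^^ n) f t + (dt ^^ n) g t)"
proof (induction n)
  case 0
  show ?case by simp
next
  case (Suc n)
  have "vector_derivative (\<lambda>t. c * (dt ^^ n) f t + (dt ^^ n) g t) (at t) =
        c * vector_derivative ((dt ^^ n) f) (at t) + vector_derivative ((dt ^^ n) g) (at t)" for t
  proof (rule vector_derivative_at)
    have "((dt ^^ n) f has_vector_derivative vector_derivative ((dt ^^ n) f) (at t)) (at t)"
      and "((dt ^^ n) g has_vector_derivative vector_derivative ((dt ^^ n) g) (at t)) (at t)"
      using assms by (auto simp: smooth_def vector_derivative_works)
    then show "((\<lambda>t. c * (dt ^^ n) f t + (dt ^^ n) g t) has_vector_derivative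
        c * vector_derivative ((dt ^^ n) f) (at t) + vector_derivative ((dt ^^ n) g) (at t)) (at t)"
      by (intro has_vector_derivative_add has_vector_derivative_mult_right)
  qed
  then have "dt (\<lambda>t. c * (dt ^^ n) f t + (dt ^^ n) g t) =
      (\<lambda>t. c * dt ((dt ^^ n) f) t + dt ((dt ^^ n) g) t)"
    by (simp add: dt_def[where f = "(dt ^^ n) f"] dt_def[where f = "(dt ^^ n) g"]
        dt_def[where f = "\<lambda>t. c * (dt ^^ n) f t + (dt ^^ n) g t"])
  then show ?case
    by (simp add: Suc.IH)
qed

lemma smooth_linear:
  assumes "smooth f" "smooth g"
  shows "smooth (\<lambda>t. c * f t + g t)"
  using assms unfolding smooth_def dt_funpow_linear[OF assms]
  by (auto intro!: differentiable_add differentiable_mult)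

lemma dt_linear:
  assumes "smooth f" "smooth g"
  shows "dt (\<lambda>t. c * f t + g t) = (\<lambda>t. c * dt f t + dt g t)"
  using dt_funpow_linear[OF assms, of 1] by simp

lemma dt_zero: "dt (\<lambda>t. 0) = (\<lambda>t. 0)"
  by (simp add: dt_def)

lemma smooth_zero: "smooth (\<lambda>t. 0)"
proof -
  have "(dt ^^ n) (\<lambda>t. 0) = (\<lambda>t. 0::'a)" for n
    by (induction n) (simp_all add: dt_zero)
  then show ?thesis by (simp add: smooth_def)
qed

lemma smooth_tensor_zero_aux:
  fixes smul :: "'k::real_normed_field \<Rightarrow> 'a::ab_group_add \<Rightarrow> 'a"
    and smul' :: "'k \<Rightarrow> 'b::ab_group_add \<Rightarrow> 'b"
  assumes vs: "vector_space smul" and V: "module.subspace smul V" and vs': "vector_space smul'"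
    and bl: "\<And>v. v \<in> V \<Longrightarrow> linear_map_on (pointwise_scale (*)) smul' {f. smooth f} UNIV (\<lambda>f. \<beta> f v)"
    and br: "\<And>f. smooth f \<Longrightarrow> linear_map_on smul smul' V UNIV (\<beta> f)"
    and xs: "set xs \<subseteq> {f. smooth f} \<times> V" and zero: "tensor_sum smul xs = (\<lambda>t. 0)"
  shows "(\<Sum>(f, v)\<leftarrow>xs. \<beta> f v) = 0"
proof -
  interpret a: vector_space smul by fact
  interpret b: vector_space smul' by fact
  have \<beta>l: "\<beta> (\<lambda>t. c * f t + g t) v = smul' c (\<beta> f v) + \<beta> g v"
    if "v \<in> V" "smooth f" "smooth g" for c f g v
  proof -
    have "smooth (\<lambda>t. c * f t)" using smooth_linear[OF that(2) smooth_zero, of c] by simp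
    then show ?thesis
      using that bl[OF that(1)]
      by (auto simp: linear_map_on_def pointwise_scale_def plus_fun_def)
  qed
  have \<beta>0: "\<beta> (\<lambda>t. 0) v = 0" if "v \<in> V" for v
    using \<beta>l[OF that smooth_zero smooth_zero, of 1] by simp
  have \<beta>r0: "\<beta> f 0 = 0" if "smooth f" for f
    using br[OF that] a.subspace_0[OF V] unfolding linear_map_on_def
    by (metis a.scale_zero_left b.scale_zero_left)
  have \<beta>r: "\<beta> f (\<Sum>b\<in>T. smul (c b) b) = (\<Sum>b\<in>T. smul' (c b) (\<beta> f b))"
    if f: "smooth f" and "finite T" "T \<subseteq> V" for f T c
    using that(2,3)
  proof (induction T rule: finite_induct)
    case empty
    show ?case using \<beta>r0[OF f] by simp
  next
    case (insert x T)
    have "(\<Sum>b\<in>T. smul (c b) b) \<in> V" "smul (c x) x \<in> V" "x \<in> V"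
      using insert.prems V by (auto intro!: a.subspace_sum a.subspace_scale)
    then show ?case
      using insert br[OF f] by (simp add: linear_map_on_def)
  qed
  obtain B where B: "B \<subseteq> snd ` set xs" "a.independent B" "snd ` set xs \<subseteq> a.span B"
    by (rule a.maximal_independent_subset)
  have BV: "B \<subseteq> V" using B(1) xs by fastforce
  have finB: "finite B" using B(1) finite_subset by blast
  define r where "r v b = a.representation B v b" for v b
  have r: "(\<Sum>b\<in>B. smul (r v b) b) = v" if "v \<in> snd ` set xs" for v
    unfolding r_def using that B finB
    by (intro a.sum_representation_eq) auto
  define coef where "coef ys b = (\<lambda>t. \<Sum>(f, v)\<leftarrow>ys. r v b * f t)" for ys :: "((real \<Rightarrow> 'k) \<times> 'a) list" and b
  have main: "smooth (coef ys b) \<and>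
      tensor_sum smul ys = (\<lambda>t. \<Sum>b\<in>B. smul (coef ys b t) b) \<and>
      (\<Sum>(f, v)\<leftarrow>ys. \<beta> f v) = (\<Sum>b\<in>B. \<beta> (coef ys b) b)" if "set ys \<subseteq> set xs" for ys b
    using that
  proof (induction ys arbitrary: b)
    case Nil
    have "(\<Sum>b\<in>B. \<beta> (\<lambda>t. 0) b) = 0" using \<beta>0 BV by (intro sum.neutral) auto
    then show ?case by (simp add: coef_def tensor_sum_def smooth_zero)
  next
    case (Cons y ys)
    obtain f v where y: "y = (f, v)" by force
    have f: "smooth f" and v: "v \<in> snd ` set xs" using Cons.prems xs y by force+
    have IH: "smooth (coef ys b)" "tensor_sum smul ys = (\<lambda>t. \<Sum>b\<in>B. smul (coef ys b t) b)"
       "(\<Sum>(f, v)\<leftarrow>ys. \<beta> f v) = (\<Sum>b\<in>B. \<beta> (coef ys b) b)" for b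
      using Cons.IH Cons.prems by auto
    have c: "coef (y # ys) b = (\<lambda>t. r v b * f t + coef ys b t)" for b
      by (simp add: coef_def y)
    have 1: "smooth (coef (y # ys) b)"
      unfolding c by (rule smooth_linear[OF f IH(1)])
    have 2: "tensor_sum smul (y # ys) = (\<lambda>t. \<Sum>b\<in>B. smul (coef (y # ys) b t) b)"
    proof
      fix t
      have "tensor_sum smul (y # ys) t = smul (f t) v + tensor_sum smul ys t"
        by (simp add: tensor_sum_def y)
      also have "smul (f t) v = (\<Sum>b\<in>B. smul (r v b * f t) b)"
        by (subst r[OF v, symmetric]) (simp add: a.scale_sum_right mult.commute)
      finally show "tensor_sum smul (y # ys) t = (\<Sum>b\<in>B. smul (coef (y # ys) b t) b)"
        by (simp add: IH(2) c a.scale_left_distrib sum.distrib)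
    qed
    have "\<beta> f v = (\<Sum>b\<in>B. smul' (r v b) (\<beta> f b))"
      using \<beta>r[OF f finB BV, of "r v"] r[OF v] by simp
    then have 3: "(\<Sum>(f, v)\<leftarrow>y # ys. \<beta> f v) = (\<Sum>b\<in>B. \<beta> (coef (y # ys) b) b)"
      using BV by (simp add: y IH(3) c[unfolded y] sum.distrib[symmetric] \<beta>l f IH(1) subset_iff cong: sum.cong)
    show ?case using 1 2 3 by blast
  qed
  have "coef xs b = (\<lambda>t. 0)" if "b \<in> B" for b
  proof
    fix t
    have "(\<Sum>b\<in>B. smul (coef xs b t) b) = 0"
      using main[of xs] zero by (metis order_refl)
    then show "coef xs b t = 0"
      using a.independentD[OF B(2) finB order_refl, of "\<lambda>b. coef xs b t" b] that by simp
  qed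
  then have "(\<Sum>b\<in>B. \<beta> (coef xs b) b) = 0"
    using \<beta>0 BV by (auto intro!: sum.neutral)
  then show ?thesis using main[of xs] by simp
qed

lemma smooth_tensor_well_defined:
  fixes smul :: "'k::real_normed_field \<Rightarrow> 'a::ab_group_add \<Rightarrow> 'a"
    and smul' :: "'k \<Rightarrow> 'b::ab_group_add \<Rightarrow> 'b"
  assumes vs: "vector_space smul" and V: "module.subspace smul V" and vs': "vector_space smul'"
    and bl: "\<And>v. v \<in> V \<Longrightarrow> linear_map_on (pointwise_scale (*)) smul' {f. smooth f} UNIV (\<lambda>f. \<beta> f v)"
    and br: "\<And>f. smooth f \<Longrightarrow> linear_map_on smul smul' V UNIV (\<beta> f)"
    and xs: "set xs \<subseteq> {f. smooth f} \<times> V" and ys: "set ys \<subseteq> {f. smooth f} \<times> V"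
    and eq: "tensor_sum smul xs = tensor_sum smul ys"
  shows "(\<Sum>(f, v)\<leftarrow>xs. \<beta> f v) = (\<Sum>(f, v)\<leftarrow>ys. \<beta> f v)"
proof -
  interpret a: vector_space smul by fact
  interpret b: vector_space smul' by fact
  define neg where "neg = map (\<lambda>(f :: real \<Rightarrow> 'k, v :: 'a). (f, - v))"
  have \<beta>neg: "\<beta> f (- v) = - \<beta> f v" if "smooth f" "v \<in> V" for f v
    using br[OF that(1)] that(2) unfolding linear_map_on_def
    by (metis a.scale_minus_left a.scale_one b.scale_minus_left b.scale_one)
  have n1: "set (neg ys) \<subseteq> {f. smooth f} \<times> V"
    using ys a.subspace_neg[OF V] by (auto simp: neg_def)
  have n2: "tensor_sum smul (neg ys) t = - tensor_sum smul ys t" for t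
    by (induction ys) (auto simp: neg_def tensor_sum_def)
  have n3: "(\<Sum>(f, v)\<leftarrow>neg ys. \<beta> f v) = - (\<Sum>(f, v)\<leftarrow>ys. \<beta> f v)"
    using ys by (induction ys) (auto simp: neg_def \<beta>neg)
  have "tensor_sum smul (xs @ neg ys) t = tensor_sum smul xs t + tensor_sum smul (neg ys) t" for t
    by (simp add: tensor_sum_def)
  then have "tensor_sum smul (xs @ neg ys) = (\<lambda>t. 0)"
    using n2 eq by (simp add: fun_eq_iff)
  then have "(\<Sum>(f, v)\<leftarrow>xs @ neg ys. \<beta> f v) = 0"
    using xs n1 by (intro smooth_tensor_zero_aux[OF vs V vs' bl br]) auto
  then show ?thesis using n3 by simp
qed

lemma smooth_tensor_universal:
  fixes smul :: "'k::real_normed_field \<Rightarrow> 'a::ab_group_add \<Rightarrow> 'a"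
    and smul' :: "'k \<Rightarrow> 'b::ab_group_add \<Rightarrow> 'b"
  assumes vs: "vector_space smul" and V: "module.subspace smul V" and vs': "vector_space smul'"
    and bl: "\<And>v. v \<in> V \<Longrightarrow> linear_map_on (pointwise_scale (*)) smul' {f. smooth f} UNIV (\<lambda>f. \<beta> f v)"
    and br: "\<And>f. smooth f \<Longrightarrow> linear_map_on smul smul' V UNIV (\<beta> f)"
  shows "\<exists>L. linear_map_on (pointwise_scale smul) smul' (smooth_tensor smul V) UNIV L \<and>
    (\<forall>f v. smooth f \<longrightarrow> v \<in> V \<longrightarrow> L (\<lambda>t. smul (f t) v) = \<beta> f v)"
    and "\<lbrakk>linear_map_on (pointwise_scale smul) smul' (smooth_tensor smul V) UNIV L;
      linear_map_on (pointwise_scale smul) smul' (smooth_tensor smul V) UNIV L';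
      \<And>f v. smooth f \<Longrightarrow> v \<in> V \<Longrightarrow> L (\<lambda>t. smul (f t) v) = L' (\<lambda>t. smul (f t) v);
      \<xi> \<in> smooth_tensor smul V\<rbrakk> \<Longrightarrow> L \<xi> = L' \<xi>"
proof -
  interpret a: vector_space smul by fact
  interpret b: vector_space smul' by fact
  define P where "P = (\<lambda>xs. set xs \<subseteq> {f::real \<Rightarrow> 'k. smooth f} \<times> V)"
  define S where "S xs = (\<Sum>(f, v)\<leftarrow>xs. \<beta> f v)" for xs
  define L where "L \<xi> = S (SOME xs. P xs \<and> \<xi> = tensor_sum smul xs)" for \<xi>
  have L: "L (tensor_sum smul xs) = S xs" if "P xs" for xs
  proof -
    have "\<exists>ys. P ys \<and> tensor_sum smul xs = tensor_sum smul ys" using that by blast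
    from someI_ex[OF this] show ?thesis
      unfolding L_def S_def
      by (intro smooth_tensor_well_defined[OF vs V vs' bl br]) (use that in \<open>auto simp: P_def\<close>)
  qed
  have T: "smooth_tensor smul V = {tensor_sum smul xs | xs. P xs}"
    by (simp add: smooth_tensor_def P_def)
  have add: "tensor_sum smul xs + tensor_sum smul ys = tensor_sum smul (xs @ ys)" for xs ys
    by (simp add: tensor_sum_def plus_fun_def)
  define sc where "sc c = map (\<lambda>(f :: real \<Rightarrow> 'k, v). (f, smul c v))" for c
  have sc: "pointwise_scale smul c (tensor_sum smul xs) = tensor_sum smul (sc c xs)" for c xs
    by (induction xs)
      (auto simp: tensor_sum_def pointwise_scale_def sc_def fun_eq_iff a.scale_right_distrib mult.commute)
  have Psc: "P (sc c xs)" if "P xs" for c xs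
    using that a.subspace_scale[OF V] by (auto simp: P_def sc_def)
  have Ssc: "S (sc c xs) = smul' c (S xs)" if "P xs" for c xs
    using that
  proof (induction xs)
    case Nil
    show ?case by (simp add: S_def sc_def)
  next
    case (Cons x xs)
    then show ?case
      using br by (auto simp: P_def S_def sc_def b.scale_right_distrib linear_map_on_def)
  qed
  have "linear_map_on (pointwise_scale smul) smul' (smooth_tensor smul V) UNIV L"
    unfolding linear_map_on_def T
  proof (safe; (simp only: UNIV_I)?)
    fix xs ys assume "P xs" "P ys"
    then show "L (tensor_sum smul xs + tensor_sum smul ys) =
        L (tensor_sum smul xs) + L (tensor_sum smul ys)"
      unfolding add using L[of "xs @ ys"] L[of xs] L[of ys] by (auto simp: P_def S_def)
  next
    fix c xs assume "P xs"
    then show "L (pointwise_scale smul c (tensor_sum smul xs)) = smul' c (L (tensor_sum smul xs))"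
      by (simp add: sc L Psc Ssc)
  qed
  moreover have "L (\<lambda>t. smul (f t) v) = \<beta> f v" if "smooth f" "v \<in> V" for f v
    using L[of "[(f, v)]"] that by (simp add: P_def S_def tensor_sum_def)
  ultimately show "\<exists>L. linear_map_on (pointwise_scale smul) smul' (smooth_tensor smul V) UNIV L \<and>
    (\<forall>f v. smooth f \<longrightarrow> v \<in> V \<longrightarrow> L (\<lambda>t. smul (f t) v) = \<beta> f v)"
    by blast
next
  interpret a: vector_space smul by fact
  interpret b: vector_space smul' by fact
  fix L L' \<xi>
  assume L: "linear_map_on (pointwise_scale smul) smul' (smooth_tensor smul V) UNIV L"
    and L': "linear_map_on (pointwise_scale smul) smul' (smooth_tensor smul V) UNIV L'"
    and eq: "\<And>f v. smooth f \<Longrightarrow> v \<in> V \<Longrightarrow> L (\<lambda>t. smul (f t) v) = L' (\<lambda>t. smul (f t) v)"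
    and \<xi>: "\<xi> \<in> smooth_tensor smul V"
  from \<xi> obtain xs where xs: "set xs \<subseteq> {f. smooth f} \<times> V" and \<xi>_eq: "\<xi> = tensor_sum smul xs"
    by (auto simp: smooth_tensor_def)
  have in_T: "tensor_sum smul zs \<in> smooth_tensor smul V" if "set zs \<subseteq> {f. smooth f} \<times> V" for zs
    using that by (auto simp: smooth_tensor_def)
  have L0: "M (\<lambda>t. 0) = 0"
    if "linear_map_on (pointwise_scale smul) smul' (smooth_tensor smul V) UNIV M" for M
  proof -
    have "(\<lambda>t. 0) \<in> smooth_tensor smul V" using in_T[of "[]"] by (simp add: tensor_sum_def)
    then have "M ((\<lambda>t. 0) + (\<lambda>t. 0)) = M (\<lambda>t. 0) + M (\<lambda>t. 0)"
      using that unfolding linear_map_on_def by blast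
    then show ?thesis by (simp add: plus_fun_def)
  qed
  show "L \<xi> = L' \<xi>" unfolding \<xi>_eq using xs
  proof (induction xs)
    case Nil
    show ?case using L0[OF L] L0[OF L'] by (simp add: tensor_sum_def)
  next
    case (Cons x xs)
    obtain f v where x: "x = (f, v)" by force
    have fv: "smooth f" "v \<in> V" and xs: "set xs \<subseteq> {f. smooth f} \<times> V" using Cons.prems x by auto
    have in1: "(\<lambda>t. smul (f t) v) \<in> smooth_tensor smul V"
      using in_T[of "[(f, v)]"] fv by (simp add: tensor_sum_def)
    have dec: "tensor_sum smul (x # xs) = (\<lambda>t. smul (f t) v) + tensor_sum smul xs"
      by (simp add: tensor_sum_def plus_fun_def x)
    show ?case
      unfolding dec using L L' in1 in_T[OF xs] eq[OF fv] Cons.IH[OF xs]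
      unfolding linear_map_on_def by metis
  qed
qed

lemma ddt_tensor_sum:
  fixes smul :: "'k::real_normed_field \<Rightarrow> 'a::ab_group_add \<Rightarrow> 'a"
  assumes vs: "vector_space smul" and xs: "set xs \<subseteq> {f. smooth f} \<times> UNIV"
  shows "ddt smul (tensor_sum smul xs) = tensor_sum smul (map (\<lambda>(f, v). (dt f, v)) xs)"
proof -
  interpret a: vector_space smul by fact
  have vs': "vector_space (pointwise_scale smul)"
    by unfold_locales (auto simp: pointwise_scale_def fun_eq_iff algebra_simps)
  have sum: "tensor_sum smul (map (\<lambda>(f, v). (dt f, v)) zs) = (\<Sum>(f, v)\<leftarrow>zs. (\<lambda>t. smul (dt f t) v))" for zs
    by (induction zs) (auto simp: tensor_sum_def fun_eq_iff)
  have dt_add: "dt (f + g) = (\<lambda>t. dt f t + dt g t)" if "smooth f" "smooth g" for f g :: "real \<Rightarrow> 'k"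
    using dt_linear[OF that, of 1] by (simp add: plus_fun_def)
  have dt_scale: "dt (pointwise_scale (*) c f) = (\<lambda>t. c * dt f t)" if "smooth f" for c and f :: "real \<Rightarrow> 'k"
    using dt_linear[OF that smooth_zero, of c] by (simp add: pointwise_scale_def dt_zero)
  have "tensor_sum smul (map (\<lambda>(f, v). (dt f, v)) ys) = tensor_sum smul (map (\<lambda>(f, v). (dt f, v)) xs)"
    if "set ys \<subseteq> {f. smooth f} \<times> UNIV" "tensor_sum smul ys = tensor_sum smul xs" for ys
    unfolding sum
  proof (rule smooth_tensor_well_defined[OF vs a.subspace_UNIV vs' _ _ that(1) xs that(2)])
    show "linear_map_on (pointwise_scale (*)) (pointwise_scale smul) {f. smooth f} UNIV (\<lambda>f t. smul (dt f t) v)" for v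
      by (simp add: linear_map_on_def dt_add dt_scale a.scale_left_distrib)
        (simp add: fun_eq_iff pointwise_scale_def)
    show "linear_map_on smul (pointwise_scale smul) UNIV UNIV (\<lambda>v t. smul (dt f t) v)" for f :: "real \<Rightarrow> 'k"
      by (simp add: linear_map_on_def fun_eq_iff pointwise_scale_def a.scale_right_distrib mult.commute)
  qed
  then show ?thesis
    unfolding ddt_def using xs
    by (intro the_equality exI[of _ xs] conjI refl) (simp, metis)
qed

section \<open>The extension by \<open>\<and> dt\<close>\<close>

text \<open>A pair \<open>(\<xi>, \<xi>')\<close> in degree \<open>n\<close> stands for \<open>\<xi> + \<xi>' \<and> dt\<close>, so \<open>\<xi>'\<close> has degree \<open>n - 1\<close>.\<close>

definition F_ext ::
  "('k::real_normed_field \<Rightarrow> 'a::ab_group_add \<Rightarrow> 'a) \<Rightarrow> (int \<Rightarrow> 'a set) \<Rightarrow> int \<Rightarrow> ((real \<Rightarrow> 'a) \<times> (real \<Rightarrow> 'a)) set"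
where
  "F_ext smul F n = smooth_tensor smul (F n) \<times> smooth_tensor smul (F (n - 1))"

definition scale_ext ::
  "('k \<Rightarrow> 'a \<Rightarrow> 'a) \<Rightarrow> 'k \<Rightarrow> (real \<Rightarrow> 'a) \<times> (real \<Rightarrow> 'a) \<Rightarrow> (real \<Rightarrow> 'a) \<times> (real \<Rightarrow> 'a)"
where
  "scale_ext smul c = (\<lambda>(\<xi>, \<xi>'). (pointwise_scale smul c \<xi>, pointwise_scale smul c \<xi>'))"

definition Laplacian :: "(int \<Rightarrow> 'a \<Rightarrow> 'a) \<Rightarrow> (int \<Rightarrow> 'a \<Rightarrow> 'a::ab_group_add) \<Rightarrow> int \<Rightarrow> 'a \<Rightarrow> 'a" where
  "Laplacian d \<delta> n x = \<delta> (n + 1) (d n x) + d (n - 1) (\<delta> n x)"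

definition d_alpha ::
  "('k::real_normed_field \<Rightarrow> 'a::ab_group_add \<Rightarrow> 'a) \<Rightarrow> (int \<Rightarrow> 'a \<Rightarrow> 'a) \<Rightarrow> (int \<Rightarrow> 'a \<Rightarrow> 'a) \<Rightarrow> real \<Rightarrow>
    int \<Rightarrow> (real \<Rightarrow> 'a) \<times> (real \<Rightarrow> 'a) \<Rightarrow> (real \<Rightarrow> 'a) \<times> (real \<Rightarrow> 'a)"
where
  "d_alpha smul d \<delta> \<alpha> n = (\<lambda>(\<xi>, \<xi>').
     (\<lambda>t. d n (\<xi> t),
      \<lambda>t. smul ((-1) powi n) (ddt smul \<xi> t)
         + smul ((-1) powi n * of_real \<alpha>) (Laplacian d \<delta> n (\<xi> t))
         + d (n - 1) (\<xi>' t)))"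

text \<open>In \<open>\<xi>' \<and> dt \<and>\<^sub>\<alpha> \<eta> = (-1)\<^sup>m (\<xi>' \<and> \<eta>) \<and> dt\<close> the sign involves only the degree \<open>m\<close> of \<open>\<eta>\<close>.\<close>

definition wedge_alpha ::
  "('k::real_normed_field \<Rightarrow> 'a::ab_group_add \<Rightarrow> 'a) \<Rightarrow> (int \<Rightarrow> int \<Rightarrow> 'a \<Rightarrow> 'a \<Rightarrow> 'a) \<Rightarrow>
    (int \<Rightarrow> 'a \<Rightarrow> 'a) \<Rightarrow> real \<Rightarrow> int \<Rightarrow> int \<Rightarrow>
    (real \<Rightarrow> 'a) \<times> (real \<Rightarrow> 'a) \<Rightarrow> (real \<Rightarrow> 'a) \<times> (real \<Rightarrow> 'a) \<Rightarrow> (real \<Rightarrow> 'a) \<times> (real \<Rightarrow> 'a)"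
where
  "wedge_alpha smul w \<delta> \<alpha> n m = (\<lambda>(\<xi>, \<xi>') (\<eta>, \<eta>').
     (\<lambda>t. w n m (\<xi> t) (\<eta> t),
      \<lambda>t. - smul ((-1) powi (n + m) * of_real \<alpha>)
              (\<delta> (n + m) (w n m (\<xi> t) (\<eta> t))
               - w (n - 1) m (\<delta> n (\<xi> t)) (\<eta> t)
               - smul ((-1) powi n) (w n (m - 1) (\<xi> t) (\<delta> m (\<eta> t))))
         + smul ((-1) powi m) (w (n - 1) m (\<xi>' t) (\<eta> t))
         + w n (m - 1) (\<xi> t) (\<eta>' t)))"

end

theory Submission
  imports Defs
begin

text \<open>Write \<open>B(x, y) = \<delta>(x \<and> y) - \<delta>x \<and> y - (-1)\<^sup>n x \<and> \<delta>y\<close> with \<open>n = |x|\<close> for the failure of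
  \<open>\<delta>\<close> to be a graded derivation; it is called \<open>defect\<close> below. On elements \<open>\<xi>\<close>, \<open>\<eta>\<close> without a
  \<open>\<and> dt\<close> component, and up to sign, the \<open>\<and> dt\<close> component of \<open>d\<^sub>\<alpha> \<xi>\<close> is \<open>(\<partial>/\<partial>t + \<alpha>\<Delta>) \<xi>\<close> and that of
  \<open>\<xi> \<and>\<^sub>\<alpha> \<eta>\<close> is \<open>\<alpha> B(\<xi>, \<eta>)\<close>. Each of the three identities required of a DGA then comes down to a
  property of \<open>\<partial>/\<partial>t\<close>, \<open>\<Delta>\<close> and \<open>B\<close>.

  The differential squares to zero because \<open>\<partial>/\<partial>t + \<alpha>\<Delta>\<close> commutes with \<open>d\<close>: the map \<open>\<Delta>\<close> is a graded
  commutator with \<open>d\<close> (\<open>d_Laplacian\<close>), and \<open>d\<close> acts on the vector factor only (\<open>ddt_d\<close>).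

  The product is associative because \<open>B\<close> is a Hochschild 2-cocycle, being the Hochschild
  coboundary of \<open>\<delta>\<close> (\<open>defect_cocycle\<close>).

  The Leibniz rule holds because \<open>\<partial>/\<partial>t\<close> is a derivation of the product (\<open>ddt_w\<close>), whereas \<open>\<Delta>\<close> is
  one only up to homotopy, with \<open>B\<close> as the homotopy: \<open>\<Delta>(x \<and> y) - \<Delta>x \<and> y - x \<and> \<Delta>y\<close> equals
  \<open>d B(x, y) + B(dx, y) + (-1)\<^sup>n B(x, dy)\<close> (\<open>Laplacian_w\<close>). The correction term of \<open>\<and>\<^sub>\<alpha>\<close>
  compensates exactly this failure.

  The analytic part of the proof is that the algebraic tensor products with \<open>C\<^sup>\<infinity>(\<real>)\<close> are stable
  under pointwise linear and bilinear operations, and that \<open>\<partial>/\<partial>t\<close> commutes with the former and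
  obeys the product rule for the latter (\<open>has_ddt_linear\<close>, \<open>has_ddt_bilinear\<close>); this rests on the
  product of smooth functions being smooth.\<close>

section \<open>Smooth functions form an algebra\<close>

lemma smooth_differentiable: "smooth f \<Longrightarrow> f differentiable (at t)"
  unfolding smooth_def by (drule spec[of _ 0]) simp

lemma smooth_dt: "smooth f \<Longrightarrow> smooth (dt f)"
  unfolding smooth_def
proof (intro allI)
  fix n t
  assume "\<forall>n t. (dt ^^ n) f differentiable at t"
  then have "(dt ^^ Suc n) f differentiable at t" by blast
  then show "(dt ^^ n) (dt f) differentiable at t" by (simp only: funpow_Suc_right comp_apply)
qed

text \<open>Smoothness is the largest property that implies differentiability and passes to the
  derivative, so it can be shown by exhibiting any family with these two closure properties.\<close>

lemma smooth_coinduct: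
  assumes "f \<in> S"
    and "\<And>g t. g \<in> S \<Longrightarrow> g differentiable (at t)"
    and "\<And>g. g \<in> S \<Longrightarrow> dt g \<in> S"
  shows "smooth f"
proof -
  have "(dt ^^ n) f \<in> S" for n
    by (induction n) (use assms in auto)
  with assms(2) show ?thesis
    by (auto simp: smooth_def)
qed

lemma dt_works: "smooth f \<Longrightarrow> (f has_vector_derivative dt f t) (at t)"
  unfolding dt_def by (simp only: smooth_differentiable vector_derivative_works[symmetric])

lemma has_vector_derivative_prod:
  assumes "smooth f" "smooth g"
  shows "((\<lambda>t. f t * g t) has_vector_derivative dt f t * g t + f t * dt g t) (at t)"
  using has_vector_derivative_mult[OF dt_works dt_works, OF assms, of t] by (simp add: add.commute)

lemma dt_prod: "smooth f \<Longrightarrow> smooth g \<Longrightarrow> dt (\<lambda>t. f t * g t) = (\<lambda>t. dt f t * g t + f t * dt g t)"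
  by (rule ext, subst dt_def, rule vector_derivative_at, rule has_vector_derivative_prod)

text \<open>The derivative of a product of two smooth functions is a sum of two such products, so by the
  product rule the finite sums of products are closed under differentiation; coinduction over
  these sums replaces the binomial formula for higher derivatives.\<close>

lemma smooth_prod:
  fixes f g :: "real \<Rightarrow> 'k::real_normed_field"
  assumes "smooth f" "smooth g"
  shows "smooth (\<lambda>t. f t * g t)"
proof (rule smooth_coinduct)
  define T where "T xs = (\<lambda>t. \<Sum>(f, g)\<leftarrow>xs. f t * g t)" for xs :: "((real \<Rightarrow> 'k) \<times> (real \<Rightarrow> 'k)) list"
  define S where "S = {T xs | xs. set xs \<subseteq> {f. smooth f} \<times> {f. smooth f}}"
  have "(\<lambda>t. f t * g t) = T [(f, g)]"
    by (simp add: T_def)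
  then show "(\<lambda>t. f t * g t) \<in> S"
    unfolding S_def using assms by fastforce
  have deriv: "\<exists>ys. set ys \<subseteq> {f. smooth f} \<times> {f. smooth f} \<and>
      (\<forall>t. (T xs has_vector_derivative T ys t) (at t))"
    if "set xs \<subseteq> {f. smooth f} \<times> {f. smooth f}" for xs
    using that
  proof (induction xs)
    case Nil
    show ?case by (rule exI[of _ "[]"]) (simp add: T_def)
  next
    case (Cons x xs)
    obtain a b where x: "x = (a, b)" by force
    obtain ys where ys: "set ys \<subseteq> {f. smooth f} \<times> {f. smooth f}"
      "\<And>t. (T xs has_vector_derivative T ys t) (at t)"
      using Cons by auto
    have ab: "smooth a" "smooth b" using Cons.prems x by auto
    have *: "T (x # xs) = (\<lambda>t. a t * b t + T xs t)"
      "T ((dt a, b) # (a, dt b) # ys) = (\<lambda>t. dt a t * b t + a t * dt b t + T ys t)"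
      by (auto simp: T_def x add.assoc)
    show ?case
      using ys ab unfolding *(1)
      by (intro exI[of _ "(dt a, b) # (a, dt b) # ys"])
        (auto simp: *(2) smooth_dt intro!: has_vector_derivative_add has_vector_derivative_prod)
  qed
  show "h differentiable (at t)" if "h \<in> S" for h t
    using that deriv differentiableI_vector unfolding S_def by blast
  show "dt h \<in> S" if h: "h \<in> S" for h
  proof -
    obtain xs where xs: "h = T xs" "set xs \<subseteq> {f. smooth f} \<times> {f. smooth f}"
      using h unfolding S_def by blast
    obtain ys where "set ys \<subseteq> {f. smooth f} \<times> {f. smooth f}"
      "\<And>t. (T xs has_vector_derivative T ys t) (at t)"
      using deriv[OF xs(2)] by blast
    then have "dt h = T ys"
      by (auto simp: dt_def xs(1) vector_derivative_at)
    with \<open>set ys \<subseteq> _\<close> show ?thesis by (auto simp: S_def)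
  qed
qed

section \<open>Calculus of time-dependent elements\<close>

text \<open>A presentation as a finite sum \<open>\<Sum>\<^sub>i f\<^sub>i(t) v\<^sub>i\<close> determines both the element \<open>\<xi>\<close> and its derivative
  \<open>\<xi>'\<close>. The predicate records the pair, so that a single rule induction yields both that a
  time-dependent element lies in the tensor product and what its derivative is. Keeping
  \<open>v\<^sub>i \<in> V\<close> matters because the operations of a DGA are linear only on the graded pieces.\<close>

inductive has_ddt ::
  "('k::real_normed_field \<Rightarrow> 'a::ab_group_add \<Rightarrow> 'a) \<Rightarrow> 'a set \<Rightarrow> (real \<Rightarrow> 'a) \<Rightarrow> (real \<Rightarrow> 'a) \<Rightarrow> bool"
  for smul V
where
  zero: "has_ddt smul V (\<lambda>t. 0) (\<lambda>t. 0)"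
| step: "smooth f \<Longrightarrow> v \<in> V \<Longrightarrow> has_ddt smul V \<xi> \<xi>' \<Longrightarrow>
    has_ddt smul V (\<lambda>t. smul (f t) v + \<xi> t) (\<lambda>t. smul (dt f t) v + \<xi>' t)"

lemma has_ddt_iff_tensor_sum:
  "has_ddt smul V \<xi> \<xi>' \<longleftrightarrow> (\<exists>xs. set xs \<subseteq> {f. smooth f} \<times> V \<and>
     \<xi> = tensor_sum smul xs \<and> \<xi>' = tensor_sum smul (map (\<lambda>(f, v). (dt f, v)) xs))"
  (is "_ \<longleftrightarrow> (\<exists>xs. ?P xs \<xi> \<xi>')")
proof
  assume "has_ddt smul V \<xi> \<xi>'"
  then show "\<exists>xs. ?P xs \<xi> \<xi>'"
  proof induction
    case zero
    show ?case by (rule exI[of _ "[]"]) (simp add: tensor_sum_def)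
  next
    case (step f v \<xi> \<xi>')
    then obtain xs where "?P xs \<xi> \<xi>'" by blast
    with step show ?case
      by (intro exI[of _ "(f, v) # xs"]) (simp add: tensor_sum_def)
  qed
next
  have "has_ddt smul V (tensor_sum smul xs) (tensor_sum smul (map (\<lambda>(f, v). (dt f, v)) xs))"
    if "set xs \<subseteq> {f. smooth f} \<times> V" for xs
    using that
  proof (induction xs)
    case Nil
    show ?case by (simp add: tensor_sum_def has_ddt.zero)
  next
    case (Cons x xs)
    then show ?case
      using has_ddt.step[of "fst x" "snd x" V smul] by (force simp: tensor_sum_def split_beta)
  qed
  then show "\<exists>xs. ?P xs \<xi> \<xi>' \<Longrightarrow> has_ddt smul V \<xi> \<xi>'" by blast
qed

lemma smooth_tensor_iff_has_ddt: "\<xi> \<in> smooth_tensor smul V \<longleftrightarrow> (\<exists>\<xi>'. has_ddt smul V \<xi> \<xi>')"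
  unfolding smooth_tensor_def has_ddt_iff_tensor_sum by blast

context vector_space
begin

lemma linear_map_onD:
  assumes "linear_map_on scale scale V W L"
  shows "x \<in> V \<Longrightarrow> L x \<in> W" "x \<in> V \<Longrightarrow> y \<in> V \<Longrightarrow> L (x + y) = L x + L y"
    "x \<in> V \<Longrightarrow> L (scale c x) = scale c (L x)"
  using assms by (auto simp: linear_map_on_def)

lemma linear_map_on_zero: "linear_map_on scale scale V W L \<Longrightarrow> subspace V \<Longrightarrow> L 0 = 0"
  using linear_map_onD(3)[of V W L 0 0] by (simp add: subspace_0)

lemma linear_map_on_neg: "linear_map_on scale scale V W L \<Longrightarrow> x \<in> V \<Longrightarrow> L (- x) = - L x"
  using linear_map_onD(3)[of V W L x "-1"] by simp

lemma linear_map_on_diff: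
  "linear_map_on scale scale V W L \<Longrightarrow> subspace V \<Longrightarrow> x \<in> V \<Longrightarrow> y \<in> V \<Longrightarrow> L (x - y) = L x - L y"
  using linear_map_onD(2)[of V W L x "- y"] linear_map_on_neg[of V W L y] by (simp add: subspace_neg)

end

locale time_dependent = vector_space smul
  for smul :: "'k::real_normed_field \<Rightarrow> 'a::ab_group_add \<Rightarrow> 'a" (infixr \<open>\<odot>\<close> 75)
begin

lemma ddt_eq: "has_ddt smul V \<xi> \<xi>' \<Longrightarrow> ddt smul \<xi> = \<xi>'"
  unfolding has_ddt_iff_tensor_sum
proof (elim exE conjE)
  fix xs assume "set xs \<subseteq> {f. smooth f} \<times> V" "\<xi> = tensor_sum smul xs"
    "\<xi>' = tensor_sum smul (map (\<lambda>(f, v). (dt f, v)) xs)"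
  then show "ddt smul \<xi> = \<xi>'"
    using ddt_tensor_sum[OF vector_space_axioms, of xs] by blast
qed

lemma has_ddt_ddt: "\<xi> \<in> smooth_tensor smul V \<Longrightarrow> has_ddt smul V \<xi> (ddt smul \<xi>)"
  unfolding smooth_tensor_iff_has_ddt by (elim exE) (simp only: ddt_eq)

lemma has_ddt_smooth_tensor: "has_ddt smul V \<xi> \<xi>' \<Longrightarrow> \<xi> \<in> smooth_tensor smul V"
  unfolding smooth_tensor_iff_has_ddt by (rule exI)

lemma has_ddt_add:
  assumes "has_ddt smul V \<xi> \<xi>'" "has_ddt smul V \<eta> \<eta>'"
  shows "has_ddt smul V (\<lambda>t. \<xi> t + \<eta> t) (\<lambda>t. \<xi>' t + \<eta>' t)"
  using assms(1)
proof induction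
  case zero
  show ?case using assms(2) by simp
next
  case (step f v \<xi> \<xi>')
  then show ?case using has_ddt.step[OF step(1,2,4)] by (simp add: add.assoc)
qed

lemma has_ddt_mult:
  assumes "smooth g" "has_ddt smul V \<xi> \<xi>'"
  shows "has_ddt smul V (\<lambda>t. g t \<odot> \<xi> t) (\<lambda>t. dt g t \<odot> \<xi> t + g t \<odot> \<xi>' t)"
  using assms(2)
proof induction
  case zero
  show ?case using has_ddt.zero by simp
next
  case (step f v \<xi> \<xi>')
  have "has_ddt smul V (\<lambda>t. (g t * f t) \<odot> v + g t \<odot> \<xi> t)
     (\<lambda>t. dt (\<lambda>t. g t * f t) t \<odot> v + (dt g t \<odot> \<xi> t + g t \<odot> \<xi>' t))"
    using smooth_prod[OF assms(1)] step by (intro has_ddt.step) auto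
  then show ?case
    by (simp add: dt_prod assms(1) step algebra_simps)
qed

lemma has_ddt_in:
  assumes "subspace V" "has_ddt smul V \<xi> \<xi>'"
  shows "\<xi> t \<in> V" "\<xi>' t \<in> V"
proof -
  have "\<xi> t \<in> V \<and> \<xi>' t \<in> V"
    using assms(2) by induction (simp_all add: assms(1) subspace_0 subspace_add subspace_scale)
  then show "\<xi> t \<in> V" "\<xi>' t \<in> V" by auto
qed

lemma has_ddt_linear:
  assumes L: "linear_map_on smul smul V W L" and V: "subspace V" and "has_ddt smul V \<xi> \<xi>'"
  shows "has_ddt smul W (\<lambda>t. L (\<xi> t)) (\<lambda>t. L (\<xi>' t))"
  using assms(3)
proof induction
  case zero
  show ?case using has_ddt.zero linear_map_on_zero[OF L V] by simp
next
  case (step f v \<xi> \<xi>')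
  then have "has_ddt smul W (\<lambda>t. f t \<odot> L v + L (\<xi> t)) (\<lambda>t. dt f t \<odot> L v + L (\<xi>' t))"
    by (intro has_ddt.step) (auto simp: linear_map_onD[OF L])
  then show ?case
    using step has_ddt_in[OF V step(3)] V by (simp add: linear_map_onD[OF L] subspace_scale)
qed

lemma smooth_tensor_in: "subspace V \<Longrightarrow> \<xi> \<in> smooth_tensor smul V \<Longrightarrow> \<xi> t \<in> V"
  by (rule has_ddt_in(1)[OF _ has_ddt_ddt])

text \<open>The presentation of \<open>\<xi>\<close> is consumed one term \<open>f v\<close> at a time: \<open>B (f v) \<eta> = f (B v \<eta>)\<close>, where
  \<open>B v\<close> is linear, so that the rules for linear maps and for multiplication by the smooth
  function \<open>f\<close> apply.\<close>

lemma has_ddt_bilinear: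
  assumes l: "\<And>y. y \<in> W \<Longrightarrow> linear_map_on smul smul V U (\<lambda>x. B x y)"
    and r: "\<And>x. x \<in> V \<Longrightarrow> linear_map_on smul smul W U (B x)"
    and V: "subspace V" and W: "subspace W"
    and \<xi>: "has_ddt smul V \<xi> \<xi>'" and \<eta>: "has_ddt smul W \<eta> \<eta>'"
  shows "has_ddt smul U (\<lambda>t. B (\<xi> t) (\<eta> t)) (\<lambda>t. B (\<xi>' t) (\<eta> t) + B (\<xi> t) (\<eta>' t))"
  using \<xi>
proof induction
  case zero
  show ?case using has_ddt.zero by (simp add: has_ddt_in[OF W \<eta>] linear_map_on_zero[OF l V])
next
  case (step f v \<xi> \<xi>')
  have "has_ddt smul U (\<lambda>t. B v (\<eta> t)) (\<lambda>t. B v (\<eta>' t))"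
    using has_ddt_linear[OF r W \<eta>] step by blast
  from has_ddt_add[OF has_ddt_mult[OF step(1) this] step.IH] show ?case
    using step(2) has_ddt_in[OF V step(3)] has_ddt_in[OF W \<eta>] V
    by (simp add: linear_map_onD[OF l] subspace_scale ac_simps)
qed

lemma smooth_tensor_linear:
  assumes "linear_map_on smul smul V W L" "subspace V" "\<xi> \<in> smooth_tensor smul V"
  shows "(\<lambda>t. L (\<xi> t)) \<in> smooth_tensor smul W" "ddt smul (\<lambda>t. L (\<xi> t)) = (\<lambda>t. L (ddt smul \<xi> t))"
  using has_ddt_linear[OF assms(1,2) has_ddt_ddt[OF assms(3)]]
  by (blast intro: has_ddt_smooth_tensor ddt_eq)+

lemma smooth_tensor_bilinear:
  assumes "\<And>y. y \<in> W \<Longrightarrow> linear_map_on smul smul V U (\<lambda>x. B x y)"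
    and "\<And>x. x \<in> V \<Longrightarrow> linear_map_on smul smul W U (B x)"
    and "subspace V" "subspace W" "\<xi> \<in> smooth_tensor smul V" "\<eta> \<in> smooth_tensor smul W"
  shows "(\<lambda>t. B (\<xi> t) (\<eta> t)) \<in> smooth_tensor smul U"
    "ddt smul (\<lambda>t. B (\<xi> t) (\<eta> t)) = (\<lambda>t. B (ddt smul \<xi> t) (\<eta> t) + B (\<xi> t) (ddt smul \<eta> t))"
  using has_ddt_bilinear[OF assms(1-4) has_ddt_ddt[OF assms(5)] has_ddt_ddt[OF assms(6)]]
  by (blast intro: has_ddt_smooth_tensor ddt_eq)+

lemma smooth_tensor_zero: "(\<lambda>t. 0) \<in> smooth_tensor smul V"
  by (rule has_ddt_smooth_tensor[OF has_ddt.zero])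

lemma smooth_tensor_add:
  assumes "\<xi> \<in> smooth_tensor smul V" "\<eta> \<in> smooth_tensor smul V"
  shows "(\<lambda>t. \<xi> t + \<eta> t) \<in> smooth_tensor smul V"
    "ddt smul (\<lambda>t. \<xi> t + \<eta> t) = (\<lambda>t. ddt smul \<xi> t + ddt smul \<eta> t)"
  using has_ddt_add[OF assms[THEN has_ddt_ddt]]
  by (blast intro: has_ddt_smooth_tensor ddt_eq)+

lemma smooth_tensor_scale:
  assumes "\<xi> \<in> smooth_tensor smul V" "subspace V"
  shows "(\<lambda>t. c \<odot> \<xi> t) \<in> smooth_tensor smul V"
    "ddt smul (\<lambda>t. c \<odot> \<xi> t) = (\<lambda>t. c \<odot> ddt smul \<xi> t)"
proof -
  have "linear_map_on smul smul V V (smul c)"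
    using assms(2) by (auto simp: linear_map_on_def subspace_scale algebra_simps)
  note * = smooth_tensor_linear[OF this assms(2,1)]
  show "(\<lambda>t. c \<odot> \<xi> t) \<in> smooth_tensor smul V"
    "ddt smul (\<lambda>t. c \<odot> \<xi> t) = (\<lambda>t. c \<odot> ddt smul \<xi> t)" by (rule *)+
qed

lemma smooth_tensor_ddt:
  assumes "\<xi> \<in> smooth_tensor smul V"
  shows "ddt smul \<xi> \<in> smooth_tensor smul V"
proof -
  have "\<exists>\<xi>''. has_ddt smul V \<xi>' \<xi>''" if "has_ddt smul V \<eta> \<xi>'" for \<eta> \<xi>'
    using that
  proof induction
    case zero
    show ?case by (rule exI, rule has_ddt.zero)
  next
    case (step f v \<xi> \<xi>')
    then obtain \<xi>'' where "has_ddt smul V \<xi>' \<xi>''" by blast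
    from has_ddt.step[OF smooth_dt[OF step(1)] step(2) this] show ?case
      by (rule exI[of _ "\<lambda>t. dt (dt f) t \<odot> v + \<xi>'' t"])
  qed
  from this[OF has_ddt_ddt[OF assms]] show ?thesis
    by (simp only: smooth_tensor_iff_has_ddt)
qed

end

section \<open>Pointwise identities\<close>

lemma sign_eq: "(-1::'k::real_normed_field) powi n = (if even n then 1 else -1)"
  by (cases "even n") (simp_all only: power_int_minus_left_even power_int_minus_left_odd
      power_int_1_left if_True if_False not_True_eq_False not_False_eq_True)

lemma sign_simps:
  "(-1::'k::real_normed_field) powi (n + m) = (-1) powi n * (-1) powi m"
  "(-1::'k) powi (n - m) = (-1) powi n * (-1) powi m"
  "(-1::'k) powi n * (-1) powi n = 1"
  "(-1::'k) powi n * ((-1) powi n * c) = c"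
  unfolding sign_eq by (cases "even n"; cases "even m"; simp)+

locale dga_degree_lowering = dga smul F d w + time_dependent smul
  for smul :: "'k::real_normed_field \<Rightarrow> 'a::ab_group_add \<Rightarrow> 'a" (infixr \<open>\<odot>\<close> 75) and F d w +
  fixes \<delta> :: "int \<Rightarrow> 'a \<Rightarrow> 'a"
  assumes \<delta>_linear: "linear_map_on smul smul (F n) (F (n - 1)) (\<delta> n)"
begin

text \<open>Degrees are arguments of the operations, so the same degree occurs in different forms such as
  \<open>n - 1 + m\<close> and \<open>n + m - 1\<close>. In this and the following rules a degree is therefore
  a variable \<open>k\<close> constrained by an equation, which the simplifier solves by arithmetic.\<close>

lemma F_closed [simp]:
  "0 \<in> F n"
  "x \<in> F n \<Longrightarrow> y \<in> F n \<Longrightarrow> x + y \<in> F n"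
  "x \<in> F n \<Longrightarrow> y \<in> F n \<Longrightarrow> x - y \<in> F n"
  "x \<in> F n \<Longrightarrow> - x \<in> F n"
  "x \<in> F n \<Longrightarrow> c \<odot> x \<in> F n"
  "x \<in> F n \<Longrightarrow> k = n + 1 \<Longrightarrow> d n x \<in> F k"
  "x \<in> F n \<Longrightarrow> k = n - 1 \<Longrightarrow> \<delta> n x \<in> F k"
  "x \<in> F n \<Longrightarrow> y \<in> F m \<Longrightarrow> k = n + m \<Longrightarrow> w n m x y \<in> F k"
  using subspace_F[of n] linear_map_onD(1)[OF d_linear] linear_map_onD(1)[OF \<delta>_linear]
    linear_map_onD(1)[OF w_linear_left]
  by (auto simp: subspace_0 subspace_add subspace_diff subspace_neg subspace_scale)

lemmas linear_map_on_simps =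
  linear_map_onD(2,3) linear_map_on_diff[OF _ subspace_F] linear_map_on_neg

lemmas F_linear [simp] =
  linear_map_on_simps[OF d_linear] linear_map_on_simps[OF \<delta>_linear]
  linear_map_on_simps[OF w_linear_left] linear_map_on_simps[OF w_linear_right]

lemma w_assoc_degree:
  "x \<in> F n \<Longrightarrow> y \<in> F m \<Longrightarrow> z \<in> F p \<Longrightarrow> k = n + m \<Longrightarrow>
    w k p (w n m x y) z = w n (m + p) x (w m p y z)"
  using w_assoc by simp

lemma leibniz_degree:
  "x \<in> F n \<Longrightarrow> y \<in> F m \<Longrightarrow> k = n + m \<Longrightarrow>
    d k (w n m x y) = w (n + 1) m (d n x) y + ((-1) powi n) \<odot> w n (m + 1) x (d m y)"
  using leibniz by simp

lemma d_d_degree: "x \<in> F n \<Longrightarrow> k = n + 1 \<Longrightarrow> d k (d n x) = 0"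
  using d_d by simp

text \<open>The failure of \<open>\<delta>\<close> to be a graded derivation; for a BV operator \<open>\<delta>\<close> on a
  graded commutative algebra, this is the associated bracket up to sign.\<close>

definition defect :: "int \<Rightarrow> int \<Rightarrow> 'a \<Rightarrow> 'a \<Rightarrow> 'a" where
  "defect n m x y = \<delta> (n + m) (w n m x y) - w (n - 1) m (\<delta> n x) y
     - ((-1) powi n) \<odot> w n (m - 1) x (\<delta> m y)"

lemma defect_linear_left:
  "y \<in> F m \<Longrightarrow> linear_map_on smul smul (F n) (F (n + m - 1)) (\<lambda>x. defect n m x y)"
  by (auto simp: linear_map_on_def defect_def algebra_simps)

lemma defect_linear_right:
  "x \<in> F n \<Longrightarrow> linear_map_on smul smul (F m) (F (n + m - 1)) (\<lambda>y. defect n m x y)"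
  by (auto simp: linear_map_on_def defect_def algebra_simps)

lemma Laplacian_linear: "linear_map_on smul smul (F n) (F n) (Laplacian d \<delta> n)"
  by (auto simp: linear_map_on_def Laplacian_def algebra_simps)

text \<open>Both sides expand to \<open>\<delta>(x \<and> y \<and> z) - \<delta>x \<and> y \<and> z - (-1)\<^sup>n x \<and> \<delta>y \<and> z - (-1)\<^sup>n\<^sup>+\<^sup>m x \<and> y \<and> \<delta>z\<close>
  after cancelling \<open>\<delta>(x \<and> y) \<and> z\<close> on the left and \<open>x \<and> \<delta>(y \<and> z)\<close> on the right.\<close>

lemma defect_cocycle:
  assumes "x \<in> F n" "y \<in> F m" "z \<in> F p"
  shows "defect (n + m) p (w n m x y) z + w (n + m - 1) p (defect n m x y) z =
    defect n (m + p) x (w m p y z) + ((-1) powi n) \<odot> w n (m + p - 1) x (defect m p y z)"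
  using assms
  by (simp add: defect_def w_assoc_degree sign_simps algebra_simps)

text \<open>Because \<open>d\<close> is a derivation, the graded commutator of \<open>d\<close> with the deviation of \<open>\<delta>\<close> from a
  derivation is the deviation of \<open>\<Delta> = \<delta>d + d\<delta>\<close> from a derivation.\<close>

lemma Laplacian_w:
  assumes "x \<in> F n" "y \<in> F m"
  shows "Laplacian d \<delta> (n + m) (w n m x y) - d (n + m - 1) (defect n m x y) =
    w n m (Laplacian d \<delta> n x) y + w n m x (Laplacian d \<delta> m y)
    + defect (n + 1) m (d n x) y + ((-1) powi n) \<odot> defect n (m + 1) x (d m y)"
  using assms
  by (simp add: defect_def Laplacian_def leibniz_degree sign_simps algebra_simps)

lemma d_Laplacian:
  assumes "x \<in> F n"
  shows "d n (Laplacian d \<delta> n x) = Laplacian d \<delta> (n + 1) (d n x)"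
  using assms
  by (simp add: Laplacian_def d_d_degree linear_map_on_zero[OF \<delta>_linear subspace_F]
      linear_map_on_zero[OF d_linear subspace_F])

section \<open>The extended algebra\<close>

lemma smooth_tensor_F_in [simp]: "\<xi> \<in> smooth_tensor smul (F n) \<Longrightarrow> \<xi> t \<in> F n"
  by (rule smooth_tensor_in[OF subspace_F])

lemma smooth_tensor_F_neg: "\<xi> \<in> smooth_tensor smul (F n) \<Longrightarrow> (\<lambda>t. - \<xi> t) \<in> smooth_tensor smul (F n)"
  using smooth_tensor_scale(1)[OF _ subspace_F, of \<xi> n "-1"] by simp

lemma smooth_tensor_F_diff: "\<xi> \<in> smooth_tensor smul (F n) \<Longrightarrow> \<eta> \<in> smooth_tensor smul (F n) \<Longrightarrow>
    (\<lambda>t. \<xi> t - \<eta> t) \<in> smooth_tensor smul (F n)"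
  using smooth_tensor_add(1)[OF _ smooth_tensor_F_neg] by simp

lemma smooth_tensor_F_d: "\<xi> \<in> smooth_tensor smul (F n) \<Longrightarrow> k = n + 1 \<Longrightarrow>
    (\<lambda>t. d n (\<xi> t)) \<in> smooth_tensor smul (F k)"
  using smooth_tensor_linear(1)[OF d_linear subspace_F] by simp

lemma smooth_tensor_F_Laplacian: "\<xi> \<in> smooth_tensor smul (F n) \<Longrightarrow>
    (\<lambda>t. Laplacian d \<delta> n (\<xi> t)) \<in> smooth_tensor smul (F n)"
  using smooth_tensor_linear(1)[OF Laplacian_linear subspace_F] by simp

lemma smooth_tensor_F_w: "\<xi> \<in> smooth_tensor smul (F n) \<Longrightarrow> \<eta> \<in> smooth_tensor smul (F m) \<Longrightarrow> k = n + m \<Longrightarrow>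
    (\<lambda>t. w n m (\<xi> t) (\<eta> t)) \<in> smooth_tensor smul (F k)"
  using smooth_tensor_bilinear(1)[OF w_linear_left w_linear_right subspace_F subspace_F] by simp

lemma smooth_tensor_F_defect:
  "\<xi> \<in> smooth_tensor smul (F n) \<Longrightarrow> \<eta> \<in> smooth_tensor smul (F m) \<Longrightarrow> k = n + m - 1 \<Longrightarrow>
    (\<lambda>t. defect n m (\<xi> t) (\<eta> t)) \<in> smooth_tensor smul (F k)"
  using smooth_tensor_bilinear(1)[OF defect_linear_left defect_linear_right subspace_F subspace_F]
  by simp

lemmas smooth_tensor_F_closed = smooth_tensor_add(1) smooth_tensor_scale(1)[OF _ subspace_F]
  smooth_tensor_ddt smooth_tensor_F_neg smooth_tensor_F_diff smooth_tensor_F_d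
  smooth_tensor_F_Laplacian smooth_tensor_F_w smooth_tensor_F_defect

lemma ddt_d: "\<xi> \<in> smooth_tensor smul (F n) \<Longrightarrow> ddt smul (\<lambda>t. d n (\<xi> t)) = (\<lambda>t. d n (ddt smul \<xi> t))"
  by (rule smooth_tensor_linear(2)[OF d_linear subspace_F])

lemma ddt_w: "\<xi> \<in> smooth_tensor smul (F n) \<Longrightarrow> \<eta> \<in> smooth_tensor smul (F m) \<Longrightarrow>
    ddt smul (\<lambda>t. w n m (\<xi> t) (\<eta> t)) = (\<lambda>t. w n m (ddt smul \<xi> t) (\<eta> t) + w n m (\<xi> t) (ddt smul \<eta> t))"
  by (rule smooth_tensor_bilinear(2)[OF w_linear_left w_linear_right subspace_F subspace_F])

lemma Laplacian_simps [simp]: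
  "x \<in> F n \<Longrightarrow> Laplacian d \<delta> n x \<in> F n"
  "x \<in> F n \<Longrightarrow> y \<in> F n \<Longrightarrow> Laplacian d \<delta> n (x + y) = Laplacian d \<delta> n x + Laplacian d \<delta> n y"
  "x \<in> F n \<Longrightarrow> Laplacian d \<delta> n (c \<odot> x) = c \<odot> Laplacian d \<delta> n x"
  by (rule linear_map_onD[OF Laplacian_linear]; assumption)+

lemma defect_simps [simp]:
  "x \<in> F n \<Longrightarrow> y \<in> F m \<Longrightarrow> k = n + m - 1 \<Longrightarrow> defect n m x y \<in> F k"
  "x \<in> F n \<Longrightarrow> x' \<in> F n \<Longrightarrow> y \<in> F m \<Longrightarrow> defect n m (x + x') y = defect n m x y + defect n m x' y"
  "x \<in> F n \<Longrightarrow> y \<in> F m \<Longrightarrow> defect n m (c \<odot> x) y = c \<odot> defect n m x y"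
  "x \<in> F n \<Longrightarrow> y \<in> F m \<Longrightarrow> y' \<in> F m \<Longrightarrow> defect n m x (y + y') = defect n m x y + defect n m x y'"
  "x \<in> F n \<Longrightarrow> y \<in> F m \<Longrightarrow> defect n m x (c \<odot> y) = c \<odot> defect n m x y"
  by (simp_all add: linear_map_onD[OF defect_linear_left] linear_map_onD[OF defect_linear_right])

lemma wedge_alpha_eq:
  "wedge_alpha smul w \<delta> \<alpha> n m (\<xi>, \<xi>') (\<eta>, \<eta>') =
    (\<lambda>t. w n m (\<xi> t) (\<eta> t),
     \<lambda>t. - (((-1) powi (n + m) * of_real \<alpha>) \<odot> defect n m (\<xi> t) (\<eta> t))
       + ((-1) powi m) \<odot> w (n - 1) m (\<xi>' t) (\<eta> t) + w n (m - 1) (\<xi> t) (\<eta>' t))"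
  by (simp add: wedge_alpha_def defect_def)

lemma d_alpha_eq:
  "d_alpha smul d \<delta> \<alpha> n (\<xi>, \<xi>') =
    (\<lambda>t. d n (\<xi> t),
     \<lambda>t. ((-1) powi n) \<odot> ddt smul \<xi> t
       + ((-1) powi n * of_real \<alpha>) \<odot> Laplacian d \<delta> n (\<xi> t) + d (n - 1) (\<xi>' t))"
  by (simp add: d_alpha_def)

lemma scale_ext_eq: "scale_ext smul c (\<xi>, \<xi>') = (\<lambda>t. c \<odot> \<xi> t, \<lambda>t. c \<odot> \<xi>' t)"
  by (simp add: scale_ext_def pointwise_scale_def)

lemma pair_fun_add: "(\<xi>, \<xi>') + (\<eta>, \<eta>') = (\<lambda>t. \<xi> t + \<eta> t, \<lambda>t. \<xi>' t + \<eta>' t)"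
  by (simp add: plus_fun_def)

lemma F_ext_iff:
  "(\<xi>, \<xi>') \<in> F_ext smul F n \<longleftrightarrow> \<xi> \<in> smooth_tensor smul (F n) \<and> \<xi>' \<in> smooth_tensor smul (F (n - 1))"
  by (simp add: F_ext_def)

lemma vector_space_scale_ext: "vector_space (scale_ext smul)"
  by unfold_locales
    (auto simp: scale_ext_def pointwise_scale_def fun_eq_iff algebra_simps)

lemma subspace_F_ext: "module.subspace (scale_ext smul) (F_ext smul F n)"
proof -
  interpret ext: vector_space "scale_ext smul" by (rule vector_space_scale_ext)
  show ?thesis
    unfolding ext.subspace_def
    by (auto simp: F_ext_iff scale_ext_eq pair_fun_add zero_prod_def zero_fun_def
        intro!: smooth_tensor_F_closed smooth_tensor_zero simp del: add_Pair)
qed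

lemma F_ext_neg: "n < 0 \<Longrightarrow> F_ext smul F n = {0}"
proof -
  assume "n < 0"
  then have F0: "F n = {0}" "F (n - 1) = {0}" by (simp_all add: F_neg)
  have "\<xi> \<in> smooth_tensor smul {0} \<longleftrightarrow> \<xi> = (\<lambda>t. 0)" for \<xi>
    using smooth_tensor_in[OF subspace_single_0, of \<xi>] smooth_tensor_zero[of "{0}"] by auto
  then show "F_ext smul F n = {0}"
    unfolding F_ext_def F0 by (auto simp: zero_prod_def zero_fun_def)
qed

lemma d_alpha_linear:
  "linear_map_on (scale_ext smul) (scale_ext smul) (F_ext smul F n) (F_ext smul F (n + 1))
     (d_alpha smul d \<delta> \<alpha> n)"
  unfolding linear_map_on_def
proof (intro conjI ballI allI)
  fix x assume "x \<in> F_ext smul F n"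
  then show "d_alpha smul d \<delta> \<alpha> n x \<in> F_ext smul F (n + 1)"
    by (cases x) (auto simp: F_ext_iff d_alpha_eq intro!: smooth_tensor_F_closed)
next
  fix x y assume "x \<in> F_ext smul F n" "y \<in> F_ext smul F n"
  then show "d_alpha smul d \<delta> \<alpha> n (x + y) = d_alpha smul d \<delta> \<alpha> n x + d_alpha smul d \<delta> \<alpha> n y"
    by (cases x; cases y)
      (simp add: F_ext_iff d_alpha_eq pair_fun_add smooth_tensor_add(2)[of _ "F n"]
        scale_right_distrib ac_simps del: add_Pair)
next
  fix c x assume "x \<in> F_ext smul F n"
  then show "d_alpha smul d \<delta> \<alpha> n (scale_ext smul c x) = scale_ext smul c (d_alpha smul d \<delta> \<alpha> n x)"
    by (cases x)
      (simp add: F_ext_iff d_alpha_eq scale_ext_eq smooth_tensor_scale(2)[OF _ subspace_F[of n]]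
        scale_right_distrib ac_simps)
qed

lemma wedge_alpha_closed:
  "x \<in> F_ext smul F n \<Longrightarrow> y \<in> F_ext smul F m \<Longrightarrow>
    wedge_alpha smul w \<delta> \<alpha> n m x y \<in> F_ext smul F (n + m)"
  by (cases x; cases y) (auto simp: F_ext_iff wedge_alpha_eq intro!: smooth_tensor_F_closed)

lemma wedge_alpha_linear_left:
  assumes "y \<in> F_ext smul F m"
  shows "linear_map_on (scale_ext smul) (scale_ext smul) (F_ext smul F n) (F_ext smul F (n + m))
     (\<lambda>x. wedge_alpha smul w \<delta> \<alpha> n m x y)"
  unfolding linear_map_on_def
proof (intro conjI ballI allI)
  fix x assume "x \<in> F_ext smul F n"
  with assms show "wedge_alpha smul w \<delta> \<alpha> n m x y \<in> F_ext smul F (n + m)"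
    by (rule wedge_alpha_closed[rotated])
next
  fix x x' assume "x \<in> F_ext smul F n" "x' \<in> F_ext smul F n"
  with assms show "wedge_alpha smul w \<delta> \<alpha> n m (x + x') y =
      wedge_alpha smul w \<delta> \<alpha> n m x y + wedge_alpha smul w \<delta> \<alpha> n m x' y"
    by (cases x; cases x'; cases y)
      (simp add: F_ext_iff wedge_alpha_eq pair_fun_add fun_eq_iff algebra_simps del: add_Pair)
next
  fix c x assume "x \<in> F_ext smul F n"
  with assms show "wedge_alpha smul w \<delta> \<alpha> n m (scale_ext smul c x) y =
      scale_ext smul c (wedge_alpha smul w \<delta> \<alpha> n m x y)"
    by (cases x; cases y)
      (simp add: F_ext_iff wedge_alpha_eq scale_ext_eq fun_eq_iff algebra_simps)
qed

lemma wedge_alpha_linear_right: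
  assumes "x \<in> F_ext smul F n"
  shows "linear_map_on (scale_ext smul) (scale_ext smul) (F_ext smul F m) (F_ext smul F (n + m))
     (\<lambda>y. wedge_alpha smul w \<delta> \<alpha> n m x y)"
  unfolding linear_map_on_def
proof (intro conjI ballI allI)
  fix y assume "y \<in> F_ext smul F m"
  with assms show "wedge_alpha smul w \<delta> \<alpha> n m x y \<in> F_ext smul F (n + m)"
    by (rule wedge_alpha_closed)
next
  fix y y' assume "y \<in> F_ext smul F m" "y' \<in> F_ext smul F m"
  with assms show "wedge_alpha smul w \<delta> \<alpha> n m x (y + y') =
      wedge_alpha smul w \<delta> \<alpha> n m x y + wedge_alpha smul w \<delta> \<alpha> n m x y'"
    by (cases x; cases y; cases y')
      (simp add: F_ext_iff wedge_alpha_eq pair_fun_add fun_eq_iff algebra_simps del: add_Pair)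
next
  fix c y assume "y \<in> F_ext smul F m"
  with assms show "wedge_alpha smul w \<delta> \<alpha> n m x (scale_ext smul c y) =
      scale_ext smul c (wedge_alpha smul w \<delta> \<alpha> n m x y)"
    by (cases x; cases y)
      (simp add: F_ext_iff wedge_alpha_eq scale_ext_eq fun_eq_iff algebra_simps)
qed

lemma d_alpha_d_alpha:
  assumes "x \<in> F_ext smul F n"
  shows "d_alpha smul d \<delta> \<alpha> (n + 1) (d_alpha smul d \<delta> \<alpha> n x) = 0"
proof (cases x)
  case (Pair \<xi> \<xi>')
  with assms have \<xi>: "\<xi> \<in> smooth_tensor smul (F n)" "\<xi>' \<in> smooth_tensor smul (F (n - 1))"
    by (auto simp: F_ext_iff)
  then have "\<And>t. ddt smul \<xi> t \<in> F n" "\<And>t. \<xi> t \<in> F n" "\<And>t. \<xi>' t \<in> F (n - 1)"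
    by (simp_all add: smooth_tensor_ddt)
  with \<xi> show ?thesis
    by (simp add: Pair d_alpha_eq ddt_d d_d_degree d_Laplacian sign_simps zero_prod_def zero_fun_def)
qed

lemma wedge_alpha_assoc:
  assumes "x \<in> F_ext smul F n" "y \<in> F_ext smul F m" "z \<in> F_ext smul F p"
  shows "wedge_alpha smul w \<delta> \<alpha> (n + m) p (wedge_alpha smul w \<delta> \<alpha> n m x y) z =
    wedge_alpha smul w \<delta> \<alpha> n (m + p) x (wedge_alpha smul w \<delta> \<alpha> m p y z)"
proof (cases x; cases y; cases z)
  fix \<xi> \<xi>' \<eta> \<eta>' \<zeta> \<zeta>'
  assume eq: "x = (\<xi>, \<xi>')" "y = (\<eta>, \<eta>')" "z = (\<zeta>, \<zeta>')"
  have mem: "\<xi> t \<in> F n" "\<xi>' t \<in> F (n - 1)" "\<eta> t \<in> F m" "\<eta>' t \<in> F (m - 1)"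
    "\<zeta> t \<in> F p" "\<zeta>' t \<in> F (p - 1)" for t
    using assms by (auto simp: eq F_ext_iff)
  (* Solved for the term that occurs in the left-hand product, so that rewriting with it
     reduces the claim to an identity of free terms; k absorbs reordered sums of degrees. *)
  have cocycle: "defect k p (w n m (\<xi> t) (\<eta> t)) (\<zeta> t) =
      defect n (m + p) (\<xi> t) (w m p (\<eta> t) (\<zeta> t))
      + ((-1) powi n) \<odot> w n (m + p - 1) (\<xi> t) (defect m p (\<eta> t) (\<zeta> t))
      - w (n + m - 1) p (defect n m (\<xi> t) (\<eta> t)) (\<zeta> t)" if "k = n + m" for k t
    unfolding that using defect_cocycle[OF mem(1,3,5), of t t t] by (simp add: eq_diff_eq)
  show ?thesis
    using mem
    by (simp add: eq wedge_alpha_eq cocycle w_assoc_degree sign_simps fun_eq_iff algebra_simps)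
qed

lemma wedge_alpha_leibniz:
  assumes "x \<in> F_ext smul F n" "y \<in> F_ext smul F m"
  shows "d_alpha smul d \<delta> \<alpha> (n + m) (wedge_alpha smul w \<delta> \<alpha> n m x y) =
    wedge_alpha smul w \<delta> \<alpha> (n + 1) m (d_alpha smul d \<delta> \<alpha> n x) y
    + scale_ext smul ((-1) powi n) (wedge_alpha smul w \<delta> \<alpha> n (m + 1) x (d_alpha smul d \<delta> \<alpha> m y))"
proof (cases x; cases y)
  fix \<xi> \<xi>' \<eta> \<eta>'
  assume eq: "x = (\<xi>, \<xi>')" "y = (\<eta>, \<eta>')"
  have ST: "\<xi> \<in> smooth_tensor smul (F n)" "\<eta> \<in> smooth_tensor smul (F m)"
    using assms by (auto simp: eq F_ext_iff)
  have mem: "\<xi> t \<in> F n" "\<xi>' t \<in> F (n - 1)" "\<eta> t \<in> F m" "\<eta>' t \<in> F (m - 1)"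
    "ddt smul \<xi> t \<in> F n" "ddt smul \<eta> t \<in> F m" for t
    using assms by (auto simp: eq F_ext_iff smooth_tensor_ddt)
  (* After this expansion of the Laplacian of a product both sides consist of the same terms;
     k again absorbs reordered sums of degrees. *)
  have Laplacian: "Laplacian d \<delta> k (w n m (\<xi> t) (\<eta> t)) =
      w n m (Laplacian d \<delta> n (\<xi> t)) (\<eta> t) + w n m (\<xi> t) (Laplacian d \<delta> m (\<eta> t))
      + defect (n + 1) m (d n (\<xi> t)) (\<eta> t) + ((-1) powi n) \<odot> defect n (m + 1) (\<xi> t) (d m (\<eta> t))
      + d (n + m - 1) (defect n m (\<xi> t) (\<eta> t))" if "k = n + m" for k t
    unfolding that using Laplacian_w[OF mem(1,3), of t t] by (simp add: diff_eq_eq)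
  show ?thesis
    using mem
    by (simp add: eq wedge_alpha_eq d_alpha_eq scale_ext_eq pair_fun_add Laplacian leibniz_degree
        ddt_w[OF ST] sign_simps fun_eq_iff algebra_simps del: add_Pair)
qed

lemma dga_extension:
  "dga (scale_ext smul) (F_ext smul F) (d_alpha smul d \<delta> \<alpha>) (wedge_alpha smul w \<delta> \<alpha>)"
  by (intro dga.intro dga_axioms.intro vector_space_scale_ext subspace_F_ext F_ext_neg
      d_alpha_linear wedge_alpha_linear_left wedge_alpha_linear_right wedge_alpha_assoc
      d_alpha_d_alpha wedge_alpha_leibniz)

end

theorem theorem2p1:
  fixes smul :: "'k::real_normed_field \<Rightarrow> 'a::ab_group_add \<Rightarrow> 'a"
    and F :: "int \<Rightarrow> 'a set"
    and d :: "int \<Rightarrow> 'a \<Rightarrow> 'a"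
    and w :: "int \<Rightarrow> int \<Rightarrow> 'a \<Rightarrow> 'a \<Rightarrow> 'a"
    and \<delta> :: "int \<Rightarrow> 'a \<Rightarrow> 'a"
    and \<alpha> :: real
  assumes "dga smul F d w"
    and "\<And>n. linear_map_on smul smul (F n) (F (n - 1)) (\<delta> n)"
  shows "dga (scale_ext smul) (F_ext smul F) (d_alpha smul d \<delta> \<alpha>) (wedge_alpha smul w \<delta> \<alpha>)"
proof -
  interpret dga smul F d w by fact
  interpret dga_degree_lowering smul F d w \<delta>
    by unfold_locales (rule assms(2))
  show ?thesis by (rule dga_extension)
qed

end
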